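(* Let $G$ be an analytic function on $\mathbb{C}_+$ and suppose that $A:f\mapsto Gf'$ generates a $C_0$ quasicontractive group of bounded composition operators $(C_{\varphi_t})_{t\in\mathbb{R}}$ on $H^2(\mathbb{C}_+)$. Then $G(z)=pz+iq$ for some real $p$ and $q$, and hence, for $t\in\mathbb{R}$, $z\in\mathbb{C}_+$, we get $$\varphi_t(z)=ze^{pt}+\frac{iq}{p}\left(e^{pt}-1\right)$$ if $p\ne0$, and $$\varphi_t(z)=z+iqt$$ if $p=0$.
   Context: $\mathbb{C}_+=\{z\in\mathbb{C}:\operatorname{Re}z>0\}$ and $H^2(\mathbb{C}_+)$ is the Hardy space of this half-plane (analytic $f$ on $\mathbb{C}_+$ with $\sup_{x>0}\int_{\mathbb{R}}|f(x+iy)|^2\,dy<\infty$). A composition operator is $C_\varphi f=f\circ\varphi$ with $\varphi:\mathbb{C}_+\to\mathbb{C}_+$ analytic. The maps $\varphi_t$ are the solutions of $\frac{\partial\varphi_t(z)}{\partial t}=G(\varphi_t(z))$, $\varphi_0(z)=z$. A $C_0$-semigroup $(T(t))_{t\ge0}$ is a family of bounded operators with $T(0)=I$, $T(t+s)=T(t)T(s)$, and $\lim_{t\to0}T(t)x=x$ for all $x$; its generator is $Ax=\lim_{t\to0^+}(T(t)x-x)/t$, on the domain where the limit exists. It is quasicontractive if $\|T(t)\|\le e^{wt}$ for all $t\ge0$ for some $w\ge0$. $A$ generates a $C_0$ quasicontractive group if both $A$ and $-A$ generate quasicontractive $C_0$-semigroups. *)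

theory Defs
  imports "HOL-Complex_Analysis.Complex_Analysis"
begin

definition right_half_plane :: "complex set" where
  "right_half_plane = {z. 0 < Re z}"

definition line_energy :: "(complex \<Rightarrow> complex) \<Rightarrow> real \<Rightarrow> ennreal" where
  "line_energy f x = (\<integral>\<^sup>+ y. ennreal ((cmod (f (Complex x y)))\<^sup>2) \<partial>lborel)"

definition hardy_energy :: "(complex \<Rightarrow> complex) \<Rightarrow> ennreal" where
  "hardy_energy f = (SUP x\<in>{0<..}. line_energy f x)"

definition hardy_functions :: "(complex \<Rightarrow> complex) set" where
  "hardy_functions = {f. f holomorphic_on right_half_plane \<and>
     (\<forall>z. z \<notin> right_half_plane \<longrightarrow> f z = 0) \<and> hardy_energy f < top}"

lemma open_right_half_plane: "open right_half_plane"
  unfolding right_half_plane_def by (rule open_halfspace_Re_gt)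

lemma continuous_on_line:
  assumes "f holomorphic_on right_half_plane" "x > 0"
  shows "continuous_on UNIV (\<lambda>y. f (Complex x y))"
proof -
  have "continuous_on right_half_plane f"
    using assms(1) by (rule holomorphic_on_imp_continuous_on)
  moreover have "continuous_on UNIV (\<lambda>y. Complex x y)"
    by (intro continuous_intros)
  moreover have "range (\<lambda>y. Complex x y) \<subseteq> right_half_plane"
    using assms(2) by (auto simp: right_half_plane_def)
  ultimately show ?thesis
    by (rule continuous_on_compose2)
qed

lemma measurable_line:
  assumes "f holomorphic_on right_half_plane" "x > 0"
  shows "(\<lambda>y. ennreal ((cmod (f (Complex x y)))\<^sup>2)) \<in> borel_measurable lborel"
proof -
  have "continuous_on UNIV (\<lambda>y. (cmod (f (Complex x y)))\<^sup>2)"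
    using continuous_on_line[OF assms] by (intro continuous_intros)
  then have "(\<lambda>y. (cmod (f (Complex x y)))\<^sup>2) \<in> borel_measurable borel"
    by (rule borel_measurable_continuous_onI)
  then show ?thesis by simp
qed

lemma hardy_energy_scale:
  assumes "f holomorphic_on right_half_plane"
  shows "hardy_energy (\<lambda>z. c * f z) = ennreal ((cmod c)\<^sup>2) * hardy_energy f"
proof -
  have "line_energy (\<lambda>z. c * f z) x = ennreal ((cmod c)\<^sup>2) * line_energy f x" if "x > 0" for x
  proof -
    have "line_energy (\<lambda>z. c * f z) x =
      (\<integral>\<^sup>+ y. ennreal ((cmod c)\<^sup>2) * ennreal ((cmod (f (Complex x y)))\<^sup>2) \<partial>lborel)"
      unfolding line_energy_def norm_mult power_mult_distrib
      by (intro nn_integral_cong ennreal_mult) auto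
    also have "\<dots> = ennreal ((cmod c)\<^sup>2) * line_energy f x"
      unfolding line_energy_def by (rule nn_integral_cmult) (rule measurable_line[OF assms that])
    finally show ?thesis .
  qed
  then have "hardy_energy (\<lambda>z. c * f z) = (SUP x\<in>{0<..}. ennreal ((cmod c)\<^sup>2) * line_energy f x)"
    unfolding hardy_energy_def by (intro SUP_cong) auto
  also have "\<dots> = ennreal ((cmod c)\<^sup>2) * hardy_energy f"
    unfolding hardy_energy_def by (rule SUP_mult_left_ennreal[symmetric])
  finally show ?thesis .
qed

lemma norm_add_power2_le:
  fixes u v :: "'b::real_normed_vector"
  assumes "a > 0" "b > 0"
  shows "(norm (u + v))\<^sup>2 \<le> (a + b) / a * (norm u)\<^sup>2 + (a + b) / b * (norm v)\<^sup>2"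
proof -
  have "(norm (u + v))\<^sup>2 \<le> (norm u + norm v)\<^sup>2"
    by (intro power_mono norm_triangle_ineq) auto
  also have "\<dots> \<le> (a + b) / a * (norm u)\<^sup>2 + (a + b) / b * (norm v)\<^sup>2"
  proof -
    have "(a + b) / a * (norm u)\<^sup>2 + (a + b) / b * (norm v)\<^sup>2 - (norm u + norm v)\<^sup>2
        = (b * norm u - a * norm v)\<^sup>2 / (a * b)"
      using assms by (simp add: field_simps power2_eq_square)
    moreover have "\<dots> \<ge> 0" using assms by simp
    ultimately show ?thesis by linarith
  qed
  finally show ?thesis .
qed

lemma hardy_energy_add:
  assumes "f holomorphic_on right_half_plane" "g holomorphic_on right_half_plane" "a > 0" "b > 0"
  shows "hardy_energy (\<lambda>z. f z + g z)
    \<le> ennreal ((a + b) / a) * hardy_energy f + ennreal ((a + b) / b) * hardy_energy g"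
  unfolding hardy_energy_def[of "\<lambda>z. f z + g z"]
proof (rule SUP_least)
  fix x :: real assume "x \<in> {0<..}"
  then have x: "x > 0" by simp
  have c: "0 \<le> (a + b) / a" "0 \<le> (a + b) / b" using assms(3,4) by auto
  have "line_energy (\<lambda>z. f z + g z) x
    \<le> (\<integral>\<^sup>+ y. ennreal ((a + b) / a) * ennreal ((cmod (f (Complex x y)))\<^sup>2)
          + ennreal ((a + b) / b) * ennreal ((cmod (g (Complex x y)))\<^sup>2) \<partial>lborel)"
    unfolding line_energy_def
  proof (rule nn_integral_mono)
    fix y :: real
    have "ennreal ((cmod (f (Complex x y) + g (Complex x y)))\<^sup>2)
      \<le> ennreal ((a + b) / a * (cmod (f (Complex x y)))\<^sup>2 + (a + b) / b * (cmod (g (Complex x y)))\<^sup>2)"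
      by (intro ennreal_leI norm_add_power2_le assms)
    also have "\<dots> = ennreal ((a + b) / a) * ennreal ((cmod (f (Complex x y)))\<^sup>2)
          + ennreal ((a + b) / b) * ennreal ((cmod (g (Complex x y)))\<^sup>2)"
      by (simp only: ennreal_plus ennreal_mult mult_nonneg_nonneg zero_le_power2 c)
    finally show "ennreal ((cmod (f (Complex x y) + g (Complex x y)))\<^sup>2)
      \<le> ennreal ((a + b) / a) * ennreal ((cmod (f (Complex x y)))\<^sup>2)
          + ennreal ((a + b) / b) * ennreal ((cmod (g (Complex x y)))\<^sup>2)" .
  qed
  also have "\<dots> = ennreal ((a + b) / a) * line_energy f x + ennreal ((a + b) / b) * line_energy g x"
    unfolding line_energy_def
    by (simp only: nn_integral_add nn_integral_cmult measurable_line[OF assms(1) x]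
        measurable_line[OF assms(2) x] borel_measurable_times_ennreal borel_measurable_const)
  also have "\<dots> \<le> ennreal ((a + b) / a) * hardy_energy f + ennreal ((a + b) / b) * hardy_energy g"
    unfolding hardy_energy_def using x by (intro add_mono mult_left_mono SUP_upper) auto
  finally show "line_energy (\<lambda>z. f z + g z) x
    \<le> ennreal ((a + b) / a) * hardy_energy f + ennreal ((a + b) / b) * hardy_energy g" .
qed

lemma hardy_energy_zero_iff:
  assumes "f holomorphic_on right_half_plane"
  shows "hardy_energy f = 0 \<longleftrightarrow> (\<forall>z\<in>right_half_plane. f z = 0)"
proof
  assume "\<forall>z\<in>right_half_plane. f z = 0"
  then have "line_energy f x = 0" if "x > 0" for x
    using that by (simp add: line_energy_def right_half_plane_def)
  then have "hardy_energy f \<le> 0"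
    unfolding hardy_energy_def by (intro SUP_least) auto
  then show "hardy_energy f = 0" by simp
next
  assume 0: "hardy_energy f = 0"
  show "\<forall>z\<in>right_half_plane. f z = 0"
  proof
    fix z assume z: "z \<in> right_half_plane"
    define x where "x = Re z"
    have x: "x > 0" using z by (simp add: x_def right_half_plane_def)
    have "line_energy f x \<le> hardy_energy f"
      unfolding hardy_energy_def using x by (intro SUP_upper) auto
    with 0 have "line_energy f x = 0" by simp
    then have "AE y in lborel. ennreal ((cmod (f (Complex x y)))\<^sup>2) = 0"
      unfolding line_energy_def using nn_integral_0_iff_AE[OF measurable_line[OF assms x]] by simp
    then have "AE y in lborel. f (Complex x y) = 0"
      by (simp add: ennreal_eq_0_iff)
    then have ae: "AE y in lebesgue. y \<notin> {y. f (Complex x y) \<noteq> 0}"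
      using AE_completion by fastforce
    have op: "open {y. f (Complex x y) \<noteq> 0}"
      using continuous_on_line[OF assms x] by (intro open_Collect_neq) auto
    then have "negligible {y. f (Complex x y) \<noteq> 0}"
      using ae by (simp add: negligible_iff_null_sets AE_iff_null_sets)
    with op have "{y. f (Complex x y) \<noteq> 0} = {}"
      using open_not_negligible by blast
    then have "f (Complex x (Im z)) = 0" by blast
    then show "f z = 0" by (simp add: x_def)
  qed
qed

lemma hardy_functions_zero: "(\<lambda>z. 0) \<in> hardy_functions"
proof -
  have "hardy_energy (\<lambda>z. 0) = 0" by (simp add: hardy_energy_zero_iff)
  then show ?thesis by (simp add: hardy_functions_def)
qed

text \<open>Elements are extended by \<open>0\<close> off the half-plane, so that equality in \<open>hardy\<close> is equality
  of functions on the half-plane.\<close>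

typedef hardy = hardy_functions
  morphisms hardy_fun Abs_hardy
  by (rule exI, rule hardy_functions_zero)

setup_lifting type_definition_hardy

lemma hardy_functions_add:
  assumes "f \<in> hardy_functions" "g \<in> hardy_functions"
  shows "(\<lambda>z. f z + g z) \<in> hardy_functions"
proof -
  have "hardy_energy (\<lambda>z. f z + g z) \<le> ennreal ((1 + 1) / 1) * hardy_energy f + ennreal ((1 + 1) / 1) * hardy_energy g"
    using assms by (intro hardy_energy_add) (auto simp: hardy_functions_def)
  also have "\<dots> < top"
    using assms by (auto simp: hardy_functions_def ennreal_mult_less_top)
  finally show ?thesis
    using assms by (auto simp: hardy_functions_def intro!: holomorphic_intros)
qed

lemma hardy_functions_cmult:
  assumes "f \<in> hardy_functions"
  shows "(\<lambda>z. c * f z) \<in> hardy_functions"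
proof -
  from assms have f: "f holomorphic_on right_half_plane" and fin: "hardy_energy f < top"
    by (simp_all add: hardy_functions_def)
  have "hardy_energy (\<lambda>z. c * f z) < top"
    unfolding hardy_energy_scale[OF f] using fin by (intro ennreal_mult_less_top[THEN iffD2]) auto
  moreover have "(\<lambda>z. c * f z) holomorphic_on right_half_plane"
    by (intro holomorphic_on_mult holomorphic_on_const f)
  ultimately show ?thesis
    using assms by (simp add: hardy_functions_def)
qed

instantiation hardy :: real_normed_vector
begin

lift_definition zero_hardy :: hardy is "\<lambda>z. 0"
  by (rule hardy_functions_zero)

lift_definition plus_hardy :: "hardy \<Rightarrow> hardy \<Rightarrow> hardy" is "\<lambda>f g z. f z + g z"
  by (rule hardy_functions_add)

lift_definition uminus_hardy :: "hardy \<Rightarrow> hardy" is "\<lambda>f z. - f z"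
  subgoal for f using hardy_functions_cmult[of f "-1"] by simp done

lift_definition scaleR_hardy :: "real \<Rightarrow> hardy \<Rightarrow> hardy" is "\<lambda>c f z. of_real c * f z"
  by (rule hardy_functions_cmult)

lift_definition norm_hardy :: "hardy \<Rightarrow> real" is "\<lambda>f. sqrt (enn2real (hardy_energy f))" .

definition minus_hardy :: "hardy \<Rightarrow> hardy \<Rightarrow> hardy" where
  "minus_hardy f g = f + - g"

definition dist_hardy :: "hardy \<Rightarrow> hardy \<Rightarrow> real" where
  "dist_hardy f g = norm (f - g)"

definition sgn_hardy :: "hardy \<Rightarrow> hardy" where
  "sgn_hardy f = inverse (norm f) *\<^sub>R f"

definition uniformity_hardy :: "(hardy \<times> hardy) filter" where
  "uniformity_hardy = (INF e\<in>{0<..}. principal {(f, g). dist f g < e})"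

definition open_hardy :: "hardy set \<Rightarrow> bool" where
  "open_hardy U = (\<forall>x\<in>U. \<forall>\<^sub>F (x', y) in uniformity. x' = x \<longrightarrow> y \<in> U)"

instance
proof
  fix f g h :: hardy and a b :: real and U :: "hardy set"
  show "f + g + h = f + (g + h)" by transfer (simp add: add.assoc)
  show "f + g = g + f" by transfer (simp add: add.commute)
  show "0 + f = f" by transfer simp
  show "- f + f = 0" by transfer simp
  show "f - g = f + - g" by (rule minus_hardy_def)
  show "a *\<^sub>R (f + g) = a *\<^sub>R f + a *\<^sub>R g" by transfer (simp add: algebra_simps)
  show "(a + b) *\<^sub>R f = a *\<^sub>R f + b *\<^sub>R f" by transfer (simp add: algebra_simps)
  show "a *\<^sub>R b *\<^sub>R f = (a * b) *\<^sub>R f" by transfer (simp add: algebra_simps)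
  show "1 *\<^sub>R f = f" by transfer simp
  show "dist f g = norm (f - g)" by (rule dist_hardy_def)
  show "sgn f = inverse (norm f) *\<^sub>R f" by (rule sgn_hardy_def)
  show "uniformity = (INF e\<in>{0<..}. principal {(f, g :: hardy). dist f g < e})"
    by (rule uniformity_hardy_def)
  show "open U = (\<forall>x\<in>U. \<forall>\<^sub>F (x', y) in uniformity. x' = x \<longrightarrow> y \<in> U)"
    by (rule open_hardy_def)
  show norm_0: "norm f = 0 \<longleftrightarrow> f = 0" for f :: hardy
  proof transfer
    fix f assume f: "f \<in> hardy_functions"
    have "sqrt (enn2real (hardy_energy f)) = 0 \<longleftrightarrow> hardy_energy f = 0"
      using f by (auto simp: hardy_functions_def enn2real_eq_0_iff)
    also have "\<dots> \<longleftrightarrow> f = (\<lambda>z. 0)"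
      using f by (auto simp: hardy_functions_def hardy_energy_zero_iff fun_eq_iff)
    finally show "sqrt (enn2real (hardy_energy f)) = 0 \<longleftrightarrow> f = (\<lambda>z. 0)" .
  qed
  show "norm (a *\<^sub>R f) = \<bar>a\<bar> * norm f"
  proof transfer
    fix a f assume "f \<in> hardy_functions"
    then have "f holomorphic_on right_half_plane" by (simp add: hardy_functions_def)
    then show "sqrt (enn2real (hardy_energy (\<lambda>z. complex_of_real a * f z)))
      = \<bar>a\<bar> * sqrt (enn2real (hardy_energy f))"
      by (simp only: hardy_energy_scale enn2real_mult real_sqrt_mult enn2real_ennreal
          zero_le_power2 norm_of_real power2_abs real_sqrt_abs)
  qed
  show "norm (f + g) \<le> norm f + norm g"
  proof (cases "f = 0 \<or> g = 0")
    case True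
    have "f + 0 = f" "0 + g = g" by (transfer, simp)+
    with True norm_0[of f] norm_0[of g] show ?thesis by auto
  next
    case False
    have nonneg: "norm k \<ge> 0" for k :: hardy by transfer simp
    from False nonneg[of f] nonneg[of g] have "norm f > 0" "norm g > 0"
      by (auto simp: norm_0 order_less_le)
    then show ?thesis
    proof transfer
      fix f g
      define a b where "a = sqrt (enn2real (hardy_energy f))"
        and "b = sqrt (enn2real (hardy_energy g))"
      assume f: "f \<in> hardy_functions" and g: "g \<in> hardy_functions"
        and "0 < sqrt (enn2real (hardy_energy f))" "0 < sqrt (enn2real (hardy_energy g))"
      then have ab: "a > 0" "b > 0" by (simp_all add: a_def b_def)
      then have c: "0 \<le> (a + b) / a" "0 \<le> (a + b) / b" by auto
      have ea: "hardy_energy f = ennreal (a\<^sup>2)" and eb: "hardy_energy g = ennreal (b\<^sup>2)"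
        using f g by (simp_all add: a_def b_def hardy_functions_def)
      have "hardy_energy (\<lambda>z. f z + g z)
        \<le> ennreal ((a + b) / a) * ennreal (a\<^sup>2) + ennreal ((a + b) / b) * ennreal (b\<^sup>2)"
        unfolding ea[symmetric] eb[symmetric]
        using f g ab by (intro hardy_energy_add) (auto simp: hardy_functions_def)
      also have "\<dots> = ennreal ((a + b) / a * a\<^sup>2 + (a + b) / b * b\<^sup>2)"
        by (simp only: ennreal_plus ennreal_mult mult_nonneg_nonneg zero_le_power2 c)
      also have "(a + b) / a * a\<^sup>2 + (a + b) / b * b\<^sup>2 = (a + b)\<^sup>2"
        using ab by (simp add: field_simps power2_eq_square)
      finally have "enn2real (hardy_energy (\<lambda>z. f z + g z)) \<le> (a + b)\<^sup>2"
        by (simp add: enn2real_leI)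
      then have "sqrt (enn2real (hardy_energy (\<lambda>z. f z + g z))) \<le> a + b"
        using ab by (intro real_le_lsqrt) auto
      then show "sqrt (enn2real (hardy_energy (\<lambda>z. f z + g z)))
        \<le> sqrt (enn2real (hardy_energy f)) + sqrt (enn2real (hardy_energy g))"
        by (simp add: a_def b_def)
    qed
  qed
qed

end

text \<open>For linear maps over the complex numbers this is the usual notion of a \<open>C\<^sub>0\<close>-semigroup;
  complex linearity is not demanded separately because composition operators have it.\<close>

definition C0_semigroup :: "(real \<Rightarrow> 'a::real_normed_vector \<Rightarrow> 'a) \<Rightarrow> bool" where
  "C0_semigroup T \<longleftrightarrow>
     (\<forall>t\<ge>0. bounded_linear (T t)) \<and> T 0 = id \<and>
     (\<forall>t\<ge>0. \<forall>s\<ge>0. T (t + s) = T t \<circ> T s) \<and>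
     (\<forall>x. ((\<lambda>t. T t x) \<longlongrightarrow> x) (at_right 0))"

definition quasicontractive :: "(real \<Rightarrow> 'a::real_normed_vector \<Rightarrow> 'a) \<Rightarrow> bool" where
  "quasicontractive T \<longleftrightarrow> (\<exists>w\<ge>0. \<forall>t\<ge>0. onorm (T t) \<le> exp (w * t))"

text \<open>Unbounded operators are represented by their graphs.\<close>

definition generator :: "(real \<Rightarrow> 'a::real_normed_vector \<Rightarrow> 'a) \<Rightarrow> ('a \<times> 'a) set" where
  "generator T = {(x, y). ((\<lambda>t. (T t x - x) /\<^sub>R t) \<longlongrightarrow> y) (at_right 0)}"

definition generates_qc_semigroup ::
    "('a::real_normed_vector \<times> 'a) set \<Rightarrow> (real \<Rightarrow> 'a \<Rightarrow> 'a) \<Rightarrow> bool" where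
  "generates_qc_semigroup A T \<longleftrightarrow> C0_semigroup T \<and> quasicontractive T \<and> generator T = A"

text \<open>The restriction of the group to negative times is the semigroup generated by \<open>- A\<close>, run
  backwards.\<close>

definition generates_qc_group ::
    "('a::real_normed_vector \<times> 'a) set \<Rightarrow> (real \<Rightarrow> 'a \<Rightarrow> 'a) \<Rightarrow> bool" where
  "generates_qc_group A T \<longleftrightarrow>
     generates_qc_semigroup A T \<and>
     generates_qc_semigroup {(x, - y) | x y. (x, y) \<in> A} (\<lambda>t. T (- t))"

definition is_composition_operator :: "(complex \<Rightarrow> complex) \<Rightarrow> (hardy \<Rightarrow> hardy) \<Rightarrow> bool" where
  "is_composition_operator \<phi> C \<longleftrightarrow>
     \<phi> holomorphic_on right_half_plane \<and> \<phi> ` right_half_plane \<subseteq> right_half_plane \<and>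
     (\<forall>f. \<forall>z\<in>right_half_plane. hardy_fun (C f) z = hardy_fun f (\<phi> z))"

definition is_flow_of :: "(complex \<Rightarrow> complex) \<Rightarrow> (real \<Rightarrow> complex \<Rightarrow> complex) \<Rightarrow> bool" where
  "is_flow_of G \<phi> \<longleftrightarrow> (\<forall>z\<in>right_half_plane. \<phi> 0 z = z \<and>
     (\<forall>t. \<phi> t z \<in> right_half_plane \<and>
          ((\<lambda>s. \<phi> s z) has_vector_derivative G (\<phi> t z)) (at t)))"

text \<open>The graph of \<open>f \<mapsto> G f'\<close> with domain the set of \<open>f \<in> D\<close> for which \<open>G f'\<close> is again in the
  Hardy space. The maximal domain is obtained for \<open>D = UNIV\<close>.\<close>

definition derivation_operator :: "(complex \<Rightarrow> complex) \<Rightarrow> hardy set \<Rightarrow> (hardy \<times> hardy) set" where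
  "derivation_operator G D = {(f, g). f \<in> D \<and>
     (\<forall>z\<in>right_half_plane. hardy_fun g z = G z * deriv (hardy_fun f) z)}"

end

theory Submission
  imports Defs "HOL-Probability.Sinc_Integral"
begin

text \<open>
  A bounded composition operator cannot push points too close to the imaginary axis. Test it on
  the kernel \<open>w \<mapsto> 1 / (w + cnj a)\<close> with \<open>a = \<phi> z\<close>: the squared norm of the kernel is at most
  \<open>pi / Re a\<close>, while by Schwarz--Pick its image is at least of order \<open>1 / Re a\<close> on a vertical segment
  through \<open>z\<close> of length \<open>Re z\<close>, so that the squared norm of the image is at least of order
  \<open>Re z / (Re a)\<^sup>2\<close>. Hence \<open>Re z \<le> K * Re (\<phi> z)\<close>; this is \<open>bounded_composition_operator_Re\<close>.

  In a flow, \<open>\<phi> (- t)\<close> undoes \<open>\<phi> t\<close>, by uniqueness for the differential equation. The lower bound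
  for \<open>\<phi> (- t)\<close> therefore becomes an upper bound \<open>Re (\<phi> t z) \<le> K * Re z\<close> for \<open>t \<ge> 0\<close>.
  Such a bound forces a holomorphic self-map to be affine, \<open>\<phi> t z = a * z + \<i> * b\<close> with \<open>a\<close> and \<open>b\<close>
  real: its real part vanishes on the boundary, so it reflects to an entire function, which grows at
  most linearly (\<open>affine_from_Re_bound\<close>). Consequently \<open>G\<close>, the derivative of the flow at time \<open>0\<close>,
  is a limit of functions of this form and so has this form itself, and the equation for \<open>\<phi>\<close> is
  linear and can be solved explicitly.
\<close>

section \<open>Holomorphic functions whose real part is controlled by the distance to the boundary\<close>

text \<open>On the disc of radius \<open>Re z / 2\<close> about \<open>z\<close>, the real part of \<open>f - f z\<close> is at most
  \<open>A = 3 * C * Re z\<close>. Since \<open>exp\<close> turns a bound on the real part into a bound on the modulus,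
  Cauchy's inequality for \<open>exp ((f - f z) / A)\<close> estimates \<open>deriv f z / A\<close>. The factors \<open>Re z\<close> cancel,
  which makes the estimate uniform.\<close>

lemma deriv_bound_from_Re_bound:
  assumes f: "f holomorphic_on right_half_plane" and C: "C > 0"
    and bd: "\<And>z. z \<in> right_half_plane \<Longrightarrow> \<bar>Re (f z)\<bar> \<le> C * Re z"
    and z: "z \<in> right_half_plane"
  shows "cmod (deriv f z) \<le> 6 * exp 1 * C"
proof -
  define r A where "r = Re z / 2" and "A = 3 * C * Re z"
  have x: "Re z > 0" using z by (simp add: right_half_plane_def)
  then have r: "r > 0" and A: "A > 0" using C by (simp_all add: r_def A_def)
  have near: "\<bar>Re w - Re z\<bar> \<le> r" if "w \<in> cball z r" for w
    using that abs_Re_le_cmod[of "w - z"] by (simp add: dist_norm norm_minus_commute)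
  have sub: "cball z r \<subseteq> right_half_plane"
  proof
    fix w assume "w \<in> cball z r"
    from near[OF this] x show "w \<in> right_half_plane"
      unfolding right_half_plane_def r_def mem_Collect_eq by linarith
  qed
  define h where "h = (\<lambda>w. exp ((f w - f z) / A))"
  have h: "h holomorphic_on right_half_plane"
    unfolding h_def using A by (intro holomorphic_intros f) auto
  have "cmod ((deriv ^^ 1) h z) \<le> fact 1 * exp 1 / r ^ 1"
  proof (rule Cauchy_inequality)
    show "h holomorphic_on ball z r"
      using h sub ball_subset_cball holomorphic_on_subset by blast
    show "continuous_on (cball z r) h"
      using h sub holomorphic_on_imp_continuous_on holomorphic_on_subset by blast
    fix w assume "cmod (z - w) = r"
    then have w: "w \<in> cball z r" by (simp add: dist_norm)
    then have wH: "w \<in> right_half_plane" using sub by auto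
    have "Re w \<le> 3/2 * Re z" using near[OF w] unfolding r_def by linarith
    then have "C * Re w \<le> C * (3/2 * Re z)" using C by (intro mult_left_mono) auto
    then have "Re (f w) - Re (f z) \<le> A"
      using bd[OF wH] bd[OF z] mult_pos_pos[OF C x] unfolding A_def by simp
    then show "cmod (h w) \<le> exp 1"
      using A by (simp add: h_def Re_divide_of_real divide_simps)
  qed (rule r)
  moreover have "deriv h z = deriv f z / A"
  proof (rule DERIV_imp_deriv)
    have "(f has_field_derivative deriv f z) (at z)"
      using f open_right_half_plane z by (rule holomorphic_derivI)
    then show "(h has_field_derivative deriv f z / A) (at z)"
      unfolding h_def using A by (auto intro!: derivative_eq_intros)
  qed
  ultimately have "cmod (deriv f z) / A \<le> exp 1 / r"
    using A by (simp add: norm_divide)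
  then have "cmod (deriv f z) \<le> exp 1 / r * A" using A by (simp add: field_simps)
  also have "\<dots> = 6 * exp 1 * C" using x by (simp add: r_def A_def)
  finally show ?thesis .
qed

lemma closure_right_half_plane: "closure right_half_plane = {z. Re z \<ge> 0}"
  using closure_halfspace_gt[of "1::complex" 0]
  by (simp add: right_half_plane_def inner_complex_def)

lemma convex_right_half_plane: "convex right_half_plane"
  unfolding right_half_plane_def by (rule convex_halfspace_Re_gt)

text \<open>By the derivative bound \<open>f\<close> is Lipschitz, so it extends continuously to the imaginary axis,
  where its real part must vanish. The Schwarz reflection principle then continues it to an entire
  function of at most linear growth, and Liouville's theorem applies. The coefficients
  are real because the extension preserves the axis of reflection.\<close>

lemma affine_from_Re_bound:
  assumes f: "f holomorphic_on right_half_plane" and C: "C > 0"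
    and bd: "\<And>z. z \<in> right_half_plane \<Longrightarrow> \<bar>Re (f z)\<bar> \<le> C * Re z"
  shows "\<exists>a b :: real. \<forall>z\<in>right_half_plane. f z = of_real a * z + \<i> * of_real b"
proof -
  define L where "L = 6 * exp 1 * C"
  have L: "L \<ge> 0" using C by (simp add: L_def)
  have "L-lipschitz_on right_half_plane f"
  proof (rule lipschitz_onI)
    fix x y assume xy: "x \<in> right_half_plane" "y \<in> right_half_plane"
    have "cmod (f x - f y) \<le> L * cmod (x - y)"
    proof (rule field_differentiable_bound[OF convex_right_half_plane])
      fix z assume z: "z \<in> right_half_plane"
      show "(f has_field_derivative deriv f z) (at z within right_half_plane)"
        using holomorphic_derivI[OF f open_right_half_plane z]
        by (rule has_field_derivative_at_within)
      show "cmod (deriv f z) \<le> L"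
        unfolding L_def by (rule deriv_bound_from_Re_bound[OF f C bd z])
    qed (use xy in auto)
    then show "dist (f x) (f y) \<le> L * dist x y" by (simp add: dist_norm)
  qed (rule L)
  then obtain g where g: "L-lipschitz_on (closure right_half_plane) g"
      and gf: "\<And>x. x \<in> right_half_plane \<Longrightarrow> g x = f x"
    using lipschitz_extend_closure by metis
  have lip: "cmod (g x - g y) \<le> L * cmod (x - y)" if "Re x \<ge> 0" "Re y \<ge> 0" for x y
    using lipschitz_onD[OF g, of x y] that by (simp add: closure_right_half_plane dist_norm)
  have boundary: "Re (g z) = 0" if z: "Re z = 0" for z
  proof -
    have "\<bar>Re (g z)\<bar> \<le> 0 + e" if e: "e > 0" for e
    proof -
      define d where "d = e / (L + C)"
      have d: "d > 0" using e L C by (simp add: d_def)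
      have H: "z + of_real d \<in> right_half_plane" using z d by (simp add: right_half_plane_def)
      have "cmod (g z - g (z + of_real d)) \<le> L * d"
        using lip[of z "z + of_real d"] z d by simp
      then have "\<bar>Re (g z) - Re (g (z + of_real d))\<bar> \<le> L * d"
        using abs_Re_le_cmod[of "g z - g (z + of_real d)"] by simp
      moreover have "\<bar>Re (g (z + of_real d))\<bar> \<le> C * d"
        using bd[OF H] gf[OF H] z by simp
      ultimately have "\<bar>Re (g z)\<bar> \<le> (L + C) * d" by (simp add: algebra_simps)
      also have "\<dots> = e" using L C by (simp add: d_def)
      finally show ?thesis by simp
    qed
    then have "\<bar>Re (g z)\<bar> \<le> 0" by (rule field_le_epsilon)
    then show ?thesis by simp
  qed
  \<comment> \<open>A quarter turn carries the closed right half-plane to the closed upper one, and values on the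
    imaginary axis to real values, as the reflection principle requires.\<close>
  define F where "F = (\<lambda>w. \<i> * g (- \<i> * w))"
  define E where "E = (\<lambda>w. if 0 \<le> Im w then F w else cnj (F (cnj w)))"
  have E: "E holomorphic_on UNIV"
    unfolding E_def
  proof (rule Schwarz_reflection)
    have "(f \<circ> (\<lambda>w. - \<i> * w)) holomorphic_on (UNIV \<inter> {z. 0 < Im z})"
      by (rule holomorphic_on_compose_gen[OF _ f])
        (auto intro!: holomorphic_intros simp: right_half_plane_def)
    then have "(\<lambda>w. \<i> * (f \<circ> (\<lambda>w. - \<i> * w)) w) holomorphic_on (UNIV \<inter> {z. 0 < Im z})"
      by (intro holomorphic_intros)
    moreover have "\<i> * (f \<circ> (\<lambda>w. - \<i> * w)) w = F w" if "w \<in> UNIV \<inter> {z. 0 < Im z}" for w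
      using that gf[of "- \<i> * w"] by (simp add: F_def right_half_plane_def)
    ultimately show "F holomorphic_on (UNIV \<inter> {z. 0 < Im z})"
      by (rule holomorphic_transform)
    have "continuous_on (closure right_half_plane) g"
      using g by (rule lipschitz_on_continuous_on)
    then have "continuous_on {z. 0 \<le> Im z} (\<lambda>w. g (- \<i> * w))"
      by (rule continuous_on_compose2)
        (auto intro!: continuous_intros simp: closure_right_half_plane)
    then show "continuous_on (UNIV \<inter> {z. 0 \<le> Im z}) F"
      unfolding F_def by (auto intro!: continuous_intros)
    show "F z \<in> \<real>" if "z \<in> \<real>" for z
      using that boundary[of "- \<i> * z"] by (simp add: F_def complex_is_Real_iff)
  qed auto
  have F_le: "cmod (F w) \<le> cmod (g 0) + L * cmod w" if "Im w \<ge> 0" for w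
  proof -
    have "cmod (g (- \<i> * w)) \<le> cmod (g 0) + cmod (g (- \<i> * w) - g 0)"
      by (rule norm_triangle_sub)
    also have "cmod (g (- \<i> * w) - g 0) \<le> L * cmod w"
      using lip[of "- \<i> * w" 0] that by (simp add: norm_mult)
    finally show ?thesis by (simp add: F_def norm_mult)
  qed
  have "cmod (E w) \<le> (cmod (g 0) + L) * cmod w ^ 1" if w: "1 \<le> cmod w" for w
  proof -
    have "cmod (E w) \<le> cmod (g 0) + L * cmod w"
      using F_le[of w] F_le[of "cnj w"] by (auto simp: E_def)
    also have "\<dots> \<le> cmod (g 0) * cmod w + L * cmod w"
      using mult_left_mono[OF w norm_ge_zero[of "g 0"]] by simp
    finally show ?thesis by (simp add: algebra_simps)
  qed
  then have poly: "E w = (\<Sum>k\<le>1. (deriv ^^ k) E 0 / fact k * w ^ k)" for w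
    by (rule Liouville_polynomial[OF E])
  have lin: "E w = E 0 + deriv E 0 * w" for w using poly[of w] by simp
  have real: "Im (E (of_real x)) = 0" for x
    using boundary[of "- \<i> * of_real x"] by (simp add: E_def F_def)
  have E0: "E 0 = of_real (Re (E 0))" using real[of 0] by (simp add: complex_eq_iff)
  have "Im (deriv E 0) = 0" using lin[of 1] real[of 1] real[of 0] by simp
  then have E1: "deriv E 0 = of_real (Re (deriv E 0))" by (simp add: complex_eq_iff)
  have "f z = of_real (Re (deriv E 0)) * z + \<i> * of_real (- Re (E 0))"
    if z: "z \<in> right_half_plane" for z
  proof -
    have "Im (\<i> * z) \<ge> 0" using z by (simp add: right_half_plane_def)
    then have "E (\<i> * z) = \<i> * g z" by (simp add: E_def F_def mult.assoc[symmetric])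
    then have "f z = - \<i> * E (\<i> * z)" using gf[OF z] by (simp add: mult.assoc[symmetric])
    also have "\<dots> = deriv E 0 * z - \<i> * E 0" by (subst lin) (simp add: algebra_simps)
    finally show ?thesis using E0 E1 by simp
  qed
  then show ?thesis by blast
qed

section \<open>Bounded composition operators\<close>

lemma nn_integral_cauchy_kernel:
  assumes A: "A > 0"
  shows "(\<integral>\<^sup>+ y. ennreal (1 / (A\<^sup>2 + (y - b)\<^sup>2)) \<partial>lborel) = ennreal (pi / A)"
proof -
  have std: "(\<integral>\<^sup>+ y. ennreal (inverse (1 + (y::real)\<^sup>2)) \<partial>lborel) = ennreal pi"
  proof -
    have "integrable lborel (\<lambda>y::real. inverse (1 + y\<^sup>2))"
      using integrable_inverse_1_plus_square by (simp add: set_integrable_def)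
    moreover have "(LINT y|lborel. inverse (1 + y\<^sup>2)) = pi"
      using LBINT_inverse_1_plus_square
      by (simp add: interval_lebesgue_integral_def set_lebesgue_integral_def)
    ultimately show ?thesis by (subst nn_integral_eq_integral) auto
  qed
  have "(\<integral>\<^sup>+ y. ennreal (1 / (A\<^sup>2 + (y - b)\<^sup>2)) \<partial>lborel)
      = ennreal \<bar>A\<bar> * (\<integral>\<^sup>+ y. ennreal (1 / (A\<^sup>2 + ((b + A * y) - b)\<^sup>2)) \<partial>lborel)"
    using A by (intro nn_integral_real_affine) auto
  also have "(\<lambda>y. ennreal (1 / (A\<^sup>2 + ((b + A * y) - b)\<^sup>2)))
      = (\<lambda>y. ennreal (1 / A\<^sup>2) * ennreal (inverse (1 + y\<^sup>2)))"
  proof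
    fix y :: real
    have "1 / (A\<^sup>2 + ((b + A * y) - b)\<^sup>2) = 1 / A\<^sup>2 * inverse (1 + y\<^sup>2)"
      using A by (simp add: power_mult_distrib divide_simps add_pos_nonneg algebra_simps)
    then show "ennreal (1 / (A\<^sup>2 + ((b + A * y) - b)\<^sup>2))
      = ennreal (1 / A\<^sup>2) * ennreal (inverse (1 + y\<^sup>2))"
      by (simp only:) (rule ennreal_mult, auto)
  qed
  also have "(\<integral>\<^sup>+ y. ennreal (1 / A\<^sup>2) * ennreal (inverse (1 + y\<^sup>2)) \<partial>lborel)
      = ennreal (1 / A\<^sup>2) * ennreal pi"
    by (subst nn_integral_cmult) (auto simp: std)
  also have "ennreal \<bar>A\<bar> * (ennreal (1 / A\<^sup>2) * ennreal pi) = ennreal (pi / A)"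
    using A by (simp add: ennreal_mult[symmetric] power2_eq_square)
  finally show ?thesis .
qed

text \<open>Up to the factor \<open>2 * pi\<close> this is the kernel that represents evaluation at \<open>a\<close>; elements of
  \<open>hardy\<close> vanish off the half-plane.\<close>

definition reproducing_kernel :: "complex \<Rightarrow> complex \<Rightarrow> complex" where
  "reproducing_kernel a w = (if w \<in> right_half_plane then 1 / (w + cnj a) else 0)"

lemma reproducing_kernel_energy:
  assumes a: "a \<in> right_half_plane"
  shows "hardy_energy (reproducing_kernel a) \<le> ennreal (pi / Re a)"
  unfolding hardy_energy_def
proof (rule SUP_least)
  fix x :: real assume "x \<in> {0<..}"
  then have x: "x > 0" by simp
  have ra: "Re a > 0" using a by (simp add: right_half_plane_def)
  have "line_energy (reproducing_kernel a) x
      = (\<integral>\<^sup>+ y. ennreal (1 / ((x + Re a)\<^sup>2 + (y - Im a)\<^sup>2)) \<partial>lborel)"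
    unfolding line_energy_def using x
    by (intro nn_integral_cong)
      (simp add: reproducing_kernel_def right_half_plane_def norm_divide power_divide cmod_power2)
  also have "\<dots> = ennreal (pi / (x + Re a))"
    using x ra by (intro nn_integral_cauchy_kernel) auto
  also have "\<dots> \<le> ennreal (pi / Re a)"
    using x ra by (intro ennreal_leI divide_left_mono) auto
  finally show "line_energy (reproducing_kernel a) x \<le> ennreal (pi / Re a)" .
qed

lemma reproducing_kernel_in_hardy:
  assumes a: "a \<in> right_half_plane"
  shows "reproducing_kernel a \<in> hardy_functions"
proof -
  have nz: "w + cnj a \<noteq> 0" if "w \<in> right_half_plane" for w
    using that a by (auto simp: complex_eq_iff right_half_plane_def)
  have "(\<lambda>w. 1 / (w + cnj a)) holomorphic_on right_half_plane"
    using nz by (intro holomorphic_intros) auto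
  then have "reproducing_kernel a holomorphic_on right_half_plane"
    by (rule holomorphic_transform) (simp add: reproducing_kernel_def)
  moreover have "hardy_energy (reproducing_kernel a) < top"
    using reproducing_kernel_energy[OF a] by (rule le_less_trans) simp
  ultimately show ?thesis by (simp add: hardy_functions_def reproducing_kernel_def)
qed

lemma hardy_energy_eq_norm: "hardy_energy (hardy_fun f) = ennreal ((norm f)\<^sup>2)"
  by transfer (simp add: hardy_functions_def)

text \<open>Rescale the disc of radius \<open>Re z\<close> about \<open>z\<close> to the unit disc and follow \<open>\<phi>\<close> by the Cayley map
  that sends \<open>a = \<phi> z\<close> to \<open>0\<close>. The Schwarz lemma at radius one half gives
  \<open>cmod (\<phi> w - a) \<le> cmod (\<phi> w + cnj a) / 2\<close>. As \<open>\<phi> w - a\<close> and \<open>\<phi> w + cnj a\<close> differ by \<open>2 * Re a\<close>,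
  neither can be large compared with \<open>Re a\<close>.\<close>

lemma schwarz_pick_comparison:
  assumes hol: "\<phi> holomorphic_on right_half_plane"
    and maps: "\<phi> ` right_half_plane \<subseteq> right_half_plane"
    and z: "z \<in> right_half_plane" and w: "cmod (w - z) \<le> Re z / 2"
  shows "cmod (\<phi> w + cnj (\<phi> z)) \<le> 4 * Re (\<phi> z)"
proof -
  define x a where "x = Re z" and "a = \<phi> z"
  have x: "x > 0" using z by (simp add: x_def right_half_plane_def)
  have ra: "Re a > 0" using z maps by (auto simp: a_def right_half_plane_def)
  define \<psi> where "\<psi> = (\<lambda>\<zeta>. (\<phi> (z + of_real x * \<zeta>) - a) / (\<phi> (z + of_real x * \<zeta>) + cnj a))"
  have inH: "z + of_real x * \<zeta> \<in> right_half_plane" if "cmod \<zeta> < 1" for \<zeta>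
  proof -
    have "- Re \<zeta> < 1" using abs_Re_le_cmod[of \<zeta>] that by linarith
    then have "x * - Re \<zeta> < x * 1" using x by (intro mult_strict_left_mono) auto
    then show ?thesis by (simp add: right_half_plane_def x_def)
  qed
  have \<phi>H: "Re (\<phi> (z + of_real x * \<zeta>)) > 0" if "cmod \<zeta> < 1" for \<zeta>
  proof -
    have "\<phi> (z + of_real x * \<zeta>) \<in> right_half_plane" using inH[OF that] maps by blast
    then show ?thesis by (simp add: right_half_plane_def)
  qed
  have nz: "u + cnj a \<noteq> 0" if "Re u > 0" for u
    using that ra by (auto simp: complex_eq_iff)
  have "(\<phi> \<circ> (\<lambda>\<zeta>. z + of_real x * \<zeta>)) holomorphic_on ball 0 1"
    using inH by (intro holomorphic_on_compose_gen[OF _ hol]) (auto intro!: holomorphic_intros)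
  then have hol': "(\<lambda>\<zeta>. \<phi> (z + of_real x * \<zeta>)) holomorphic_on ball 0 1"
    by (simp add: o_def)
  have \<psi>_hol: "\<psi> holomorphic_on ball 0 1"
    unfolding \<psi>_def using nz \<phi>H by (intro holomorphic_intros hol') auto
  have \<psi>_lt: "cmod (\<psi> \<zeta>) < 1" if "cmod \<zeta> < 1" for \<zeta>
  proof -
    define u where "u = \<phi> (z + of_real x * \<zeta>)"
    have u: "Re u > 0" using \<phi>H[OF that] by (simp add: u_def)
    have "(cmod (u + cnj a))\<^sup>2 - (cmod (u - a))\<^sup>2 = 4 * (Re u * Re a)"
      unfolding cmod_power2 by (simp add: power2_eq_square algebra_simps)
    moreover have "Re u * Re a > 0" using u ra by simp
    ultimately have "(cmod (u - a))\<^sup>2 < (cmod (u + cnj a))\<^sup>2" by linarith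
    then have "cmod (u - a) < cmod (u + cnj a)" by (rule power2_less_imp_less) simp
    then show ?thesis
      using nz[OF u] by (simp add: \<psi>_def u_def[symmetric] norm_divide)
  qed
  define \<zeta> where "\<zeta> = (w - z) / of_real x"
  have \<zeta>: "cmod \<zeta> \<le> 1/2" using w x by (simp add: \<zeta>_def norm_divide x_def divide_simps)
  have weq: "z + of_real x * \<zeta> = w" using x by (simp add: \<zeta>_def)
  have "cmod (\<psi> \<zeta>) \<le> cmod \<zeta>"
    using Schwarz_Lemma(1)[OF \<psi>_hol _ \<psi>_lt, of \<zeta>] \<zeta> by (simp add: \<psi>_def a_def)
  then have "cmod (\<phi> w - a) / cmod (\<phi> w + cnj a) \<le> 1/2"
    using \<zeta> unfolding \<psi>_def weq norm_divide by linarith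
  moreover have "cmod (\<phi> w + cnj a) > 0"
    using nz[of "\<phi> w"] \<phi>H[of \<zeta>] \<zeta> weq by simp
  ultimately have half: "cmod (\<phi> w - a) \<le> cmod (\<phi> w + cnj a) / 2" by (simp add: divide_simps)
  have "\<phi> w + cnj a = (\<phi> w - a) + of_real (2 * Re a)"
    by (simp add: complex_eq_iff)
  then have "cmod (\<phi> w + cnj a) \<le> cmod (\<phi> w - a) + cmod (of_real (2 * Re a))"
    by (simp only: norm_triangle_ineq)
  then have "cmod (\<phi> w + cnj a) \<le> cmod (\<phi> w - a) + 2 * Re a"
    using ra by (simp only: norm_of_real abs_of_pos mult_pos_pos zero_less_numeral)
  then show ?thesis using half by (simp add: a_def)
qed

text \<open>The norm of the image of the kernel at \<open>\<phi> z\<close> is estimated from below on the single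
  line through \<open>z\<close>, on the segment where \<open>schwarz_pick_comparison\<close> applies. With
  \<open>a = \<phi> z\<close> this gives \<open>Re z / (16 * (Re a)\<^sup>2) \<le> M\<^sup>2 * pi / Re a\<close>, where \<open>M\<close> bounds the operator.\<close>

lemma bounded_composition_operator_Re:
  assumes comp: "is_composition_operator \<phi> C" and lin: "bounded_linear C"
  shows "\<exists>K>0. \<forall>z\<in>right_half_plane. Re z \<le> K * Re (\<phi> z)"
proof -
  obtain M where M: "M > 0" "\<And>f. norm (C f) \<le> norm f * M"
    using bounded_linear.pos_bounded[OF lin] by auto
  have hol: "\<phi> holomorphic_on right_half_plane"
    and maps: "\<phi> ` right_half_plane \<subseteq> right_half_plane"
    and Cf: "\<And>f z. z \<in> right_half_plane \<Longrightarrow> hardy_fun (C f) z = hardy_fun f (\<phi> z)"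
    using comp by (auto simp: is_composition_operator_def)
  have "Re z \<le> (16 * pi * M\<^sup>2) * Re (\<phi> z)" if z: "z \<in> right_half_plane" for z
  proof -
    define x a where "x = Re z" and "a = \<phi> z"
    have x: "x > 0" using z by (simp add: x_def right_half_plane_def)
    have aH: "a \<in> right_half_plane" using z maps by (auto simp: a_def)
    then have ra: "Re a > 0" by (simp add: right_half_plane_def)
    define k where "k = Abs_hardy (reproducing_kernel a)"
    have k: "hardy_fun k = reproducing_kernel a"
      unfolding k_def by (rule Abs_hardy_inverse[OF reproducing_kernel_in_hardy[OF aH]])
    have "ennreal ((norm k)\<^sup>2) \<le> ennreal (pi / Re a)"
      using reproducing_kernel_energy[OF aH] hardy_energy_eq_norm[of k] by (simp add: k)
    then have nk: "(norm k)\<^sup>2 \<le> pi / Re a" using ra by (simp add: ennreal_le_iff)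
    let ?I = "{Im z - x/2 .. Im z + x/2}"
    have "ennreal (x / (16 * (Re a)\<^sup>2))
        = (\<integral>\<^sup>+ y. ennreal (1 / (16 * (Re a)\<^sup>2)) * indicator ?I y \<partial>lborel)"
      using x by (simp add: nn_integral_cmult_indicator ennreal_mult[symmetric])
    also have "\<dots> \<le> line_energy (hardy_fun (C k)) x"
      unfolding line_energy_def
    proof (rule nn_integral_mono)
      fix y :: real
      show "ennreal (1 / (16 * (Re a)\<^sup>2)) * indicator ?I y
          \<le> ennreal ((cmod (hardy_fun (C k) (Complex x y)))\<^sup>2)"
      proof (cases "y \<in> ?I")
        case True
        define w where "w = Complex x y"
        have wH: "w \<in> right_half_plane" using x by (simp add: w_def right_half_plane_def)
        have "cmod (w - z) = \<bar>y - Im z\<bar>"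
          by (simp add: w_def x_def cmod_def)
        moreover have "\<bar>y - Im z\<bar> \<le> Re z / 2"
          using True unfolding x_def atLeastAtMost_iff by linarith
        ultimately have "cmod (w - z) \<le> Re z / 2" by simp
        then have le: "cmod (\<phi> w + cnj a) \<le> 4 * Re a"
          unfolding a_def by (rule schwarz_pick_comparison[OF hol maps z])
        have \<phi>w: "\<phi> w \<in> right_half_plane" using wH maps by auto
        have pos: "cmod (\<phi> w + cnj a) > 0"
          using \<phi>w ra by (auto simp: complex_eq_iff right_half_plane_def)
        have "(cmod (\<phi> w + cnj a))\<^sup>2 \<le> (4 * Re a)\<^sup>2" using le by (intro power_mono) auto
        then have "1 / (16 * (Re a)\<^sup>2) \<le> 1 / (cmod (\<phi> w + cnj a))\<^sup>2"
          using pos by (intro divide_left_mono) (auto simp: power_mult_distrib intro!: mult_pos_pos ra)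
        also have "\<dots> = (cmod (hardy_fun (C k) w))\<^sup>2"
          using \<phi>w by (simp add: Cf[OF wH] k reproducing_kernel_def norm_divide power_divide)
        finally show ?thesis using True by (simp add: w_def ennreal_leI)
      qed simp
    qed
    also have "\<dots> \<le> ennreal ((norm (C k))\<^sup>2)"
      unfolding hardy_energy_eq_norm[symmetric] hardy_energy_def
      using x by (intro SUP_upper) auto
    finally have "x / (16 * (Re a)\<^sup>2) \<le> (norm (C k))\<^sup>2"
      by (simp add: ennreal_le_iff)
    also have "\<dots> \<le> (norm k * M)\<^sup>2" using M(2)[of k] by (intro power_mono) auto
    also have "\<dots> \<le> pi / Re a * M\<^sup>2"
      unfolding power_mult_distrib using nk by (intro mult_right_mono) auto
    finally have "x \<le> (pi / Re a * M\<^sup>2) * (16 * (Re a)\<^sup>2)"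
      using ra by (simp add: pos_divide_le_eq)
    also have "\<dots> = (16 * pi * M\<^sup>2) * Re a" using ra by (simp add: power2_eq_square)
    finally show ?thesis by (simp add: x_def a_def)
  qed
  moreover have "16 * pi * M\<^sup>2 > 0" using M(1) by simp
  ultimately show ?thesis by blast
qed

section \<open>Holomorphic flows\<close>

text \<open>A holomorphic field need only be locally Lipschitz, but both solutions run in a compact set,
  whose convex hull \<open>K\<close> is compact and still lies in \<open>S\<close>. With a Lipschitz constant \<open>B\<close> on \<open>K\<close>, the
  squared distance of the solutions times \<open>exp (- 2 * B * s)\<close> is nonincreasing.\<close>

lemma holomorphic_ode_unique:
  fixes u v :: "real \<Rightarrow> complex"
  assumes S: "open S" "convex S" and G: "G holomorphic_on S" and t: "0 \<le> t"
    and u: "\<And>s. 0 \<le> s \<Longrightarrow> s \<le> t \<Longrightarrow> u s \<in> S \<and> (u has_vector_derivative G (u s)) (at s)"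
    and v: "\<And>s. 0 \<le> s \<Longrightarrow> s \<le> t \<Longrightarrow> v s \<in> S \<and> (v has_vector_derivative G (v s)) (at s)"
    and init: "u 0 = v 0"
  shows "u t = v t"
proof -
  define K where "K = convex hull (u ` {0..t} \<union> v ` {0..t})"
  have cont: "continuous_on {0..t} u" "continuous_on {0..t} v"
    using u v
    by (metis atLeastAtMost_iff continuous_at_imp_continuous_on has_vector_derivative_continuous)+
  then have K: "compact K"
    unfolding K_def by (intro compact_convex_hull compact_Un compact_continuous_image) auto
  have KS: "K \<subseteq> S"
    unfolding K_def using u v S(2) by (intro hull_minimal) auto
  have "deriv G holomorphic_on S" using G S(1) by (rule holomorphic_deriv)
  then have "continuous_on K (deriv G)"
    using KS holomorphic_on_imp_continuous_on holomorphic_on_subset by blast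
  then have "bounded (deriv G ` K)"
    using K compact_continuous_image compact_imp_bounded by blast
  then obtain B where B: "\<And>x. x \<in> K \<Longrightarrow> cmod (deriv G x) \<le> B"
    by (auto simp: bounded_iff)
  have lip: "cmod (G x - G y) \<le> B * cmod (x - y)" if "x \<in> K" "y \<in> K" for x y
  proof (rule field_differentiable_bound[of K G "deriv G"])
    show "convex K" by (simp add: K_def)
    show "(G has_field_derivative deriv G z) (at z within K)" if "z \<in> K" for z
      using holomorphic_derivI[OF G S(1)] KS that has_field_derivative_at_within by blast
  qed (use B that in auto)
  define d where "d = (\<lambda>s. u s - v s)"
  define e where "e = (\<lambda>s. exp (- 2 * B * s) * (d s \<bullet> d s))"
  have "e t \<le> e 0"
  proof (rule DERIV_nonpos_imp_nonincreasing[OF t])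
    fix s assume s: "0 \<le> s" "s \<le> t"
    define g where "g = G (u s) - G (v s)"
    have "(d has_vector_derivative g) (at s)"
      unfolding d_def g_def using u[OF s] v[OF s] by (intro has_vector_derivative_diff) auto
    then have "((\<lambda>s. d s \<bullet> d s) has_vector_derivative (d s \<bullet> g + g \<bullet> d s)) (at s)"
      by (intro bounded_bilinear.has_vector_derivative[OF bounded_bilinear_inner])
    then have "((\<lambda>s. d s \<bullet> d s) has_real_derivative 2 * (d s \<bullet> g)) (at s)"
      by (simp add: has_real_derivative_iff_has_vector_derivative inner_commute)
    then have "(e has_real_derivative exp (- 2 * B * s) * (2 * (d s \<bullet> g) - 2 * B * (d s \<bullet> d s))) (at s)"
      unfolding e_def by (auto intro!: derivative_eq_intros simp: algebra_simps)
    moreover have "exp (- 2 * B * s) * (2 * (d s \<bullet> g) - 2 * B * (d s \<bullet> d s)) \<le> 0"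
    proof -
      have "u s \<in> K" "v s \<in> K" unfolding K_def using s by (auto intro!: hull_inc)
      then have "norm g \<le> B * norm (d s)" unfolding g_def d_def by (rule lip)
      then have "norm (d s) * norm g \<le> norm (d s) * (B * norm (d s))"
        by (intro mult_left_mono) auto
      moreover have "d s \<bullet> g \<le> norm (d s) * norm g" by (rule norm_cauchy_schwarz)
      moreover have "norm (d s) * (B * norm (d s)) = B * (d s \<bullet> d s)"
        by (simp add: dot_square_norm power2_eq_square)
      ultimately have "2 * (d s \<bullet> g) - 2 * B * (d s \<bullet> d s) \<le> 0" by linarith
      then show ?thesis by (intro mult_nonneg_nonpos) auto
    qed
    ultimately show "\<exists>y. (e has_real_derivative y) (at s) \<and> y \<le> 0" by blast
  qed
  then have "exp (- 2 * B * t) * (d t \<bullet> d t) \<le> 0" by (simp add: e_def d_def init)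
  then have "d t \<bullet> d t \<le> 0" by (simp add: mult_le_0_iff)
  then show ?thesis by (simp add: d_def power2_norm_eq_inner[symmetric])
qed

text \<open>The curves \<open>s \<mapsto> \<phi> (- s) (\<phi> t z)\<close> and \<open>s \<mapsto> \<phi> (t - s) z\<close> solve the same equation, with
  field \<open>- G\<close>, from the same starting point.\<close>

lemma flow_backwards:
  assumes G: "G holomorphic_on right_half_plane" and flow: "is_flow_of G \<phi>"
    and t: "0 \<le> t" and z: "z \<in> right_half_plane"
  shows "\<phi> (- t) (\<phi> t z) = z"
proof -
  have fl: "\<And>w s. w \<in> right_half_plane \<Longrightarrow> \<phi> s w \<in> right_half_plane"
    and dv: "\<And>w s. w \<in> right_half_plane \<Longrightarrow> ((\<lambda>s. \<phi> s w) has_vector_derivative G (\<phi> s w)) (at s)"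
    and z0: "\<And>w. w \<in> right_half_plane \<Longrightarrow> \<phi> 0 w = w"
    using flow by (auto simp: is_flow_of_def)
  have sub: "((\<lambda>s. \<phi> (c - s) w) has_vector_derivative - G (\<phi> (c - s) w)) (at s)"
    if "w \<in> right_half_plane" for c s w
  proof -
    have "((\<lambda>s. c - s) has_vector_derivative - 1) (at s)"
      by (auto intro!: derivative_eq_intros)
    from vector_diff_chain_at[OF this dv[OF that]] show ?thesis by (simp add: o_def)
  qed
  have "\<phi> (0 - t) (\<phi> t z) = \<phi> (t - t) z"
  proof (rule holomorphic_ode_unique[OF open_right_half_plane convex_right_half_plane _ t,
        of "\<lambda>w. - G w" "\<lambda>s. \<phi> (0 - s) (\<phi> t z)" "\<lambda>s. \<phi> (t - s) z"])
    show "(\<lambda>w. - G w) holomorphic_on right_half_plane" using G by (intro holomorphic_intros)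
    show "\<phi> (0 - 0) (\<phi> t z) = \<phi> (t - 0) z" using z0[OF fl[OF z]] by simp
  qed (use sub[OF z] sub[OF fl[OF z], of 0] fl[OF z] fl[OF fl[OF z]] in auto)
  then show ?thesis using z0[OF z] by simp
qed

lemma flow_of_affine_field:
  fixes p q t :: real
  assumes u: "\<And>t. (u has_vector_derivative of_real p * u t + \<i> * of_real q) (at t)"
  shows "p \<noteq> 0 \<Longrightarrow> u t = u 0 * exp (of_real (p * t)) + \<i> * of_real q / of_real p * (exp (of_real (p * t)) - 1)"
    and "p = 0 \<Longrightarrow> u t = u 0 + \<i> * of_real q * of_real t"
proof -
  assume p: "p \<noteq> 0"
  \<comment> \<open>The stationary point of the field is \<open>- c\<close>; about it the equation is homogeneous.\<close>
  define c where "c = \<i> * of_real q / of_real p"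
  define y where "y = (\<lambda>s. exp (- (p * s)) *\<^sub>R (u s + c))"
  have pc: "of_real p * c = \<i> * of_real q" using p by (simp add: c_def)
  have "(y has_vector_derivative 0) (at s within UNIV)" for s
  proof -
    have "((\<lambda>s. exp (- (p * s))) has_real_derivative exp (- (p * s)) * - p) (at s)"
      by (auto intro!: derivative_eq_intros)
    moreover have "((\<lambda>s. u s + c) has_vector_derivative of_real p * u s + \<i> * of_real q) (at s)"
      using has_vector_derivative_add[OF u[of s] has_vector_derivative_const[of c]] by simp
    ultimately have "(y has_vector_derivative exp (- (p * s)) *\<^sub>R (of_real p * u s + \<i> * of_real q)
        + (exp (- (p * s)) * - p) *\<^sub>R (u s + c)) (at s)"
      unfolding y_def by (rule has_vector_derivative_scaleR)
    moreover have "exp (- (p * s)) *\<^sub>R (of_real p * u s + \<i> * of_real q)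
        + (exp (- (p * s)) * - p) *\<^sub>R (u s + c) = 0"
      by (simp add: scaleR_conv_of_real algebra_simps pc[symmetric])
    ultimately show ?thesis by simp
  qed
  then obtain k where k: "\<And>s. y s = k"
    using has_vector_derivative_zero_constant[of UNIV y] by auto
  then have "y t = y 0" by simp
  then have "exp (p * t) *\<^sub>R (exp (- (p * t)) *\<^sub>R (u t + c)) = exp (p * t) *\<^sub>R (u 0 + c)"
    by (simp add: y_def)
  then have "u t + c = exp (p * t) *\<^sub>R (u 0 + c)" by (simp add: mult_exp_exp)
  then have "u t = exp (of_real (p * t)) * (u 0 + c) - c"
    by (simp add: scaleR_conv_of_real exp_of_real[symmetric] eq_diff_eq del: of_real_mult)
  then show "u t = u 0 * exp (of_real (p * t)) + \<i> * of_real q / of_real p * (exp (of_real (p * t)) - 1)"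
    unfolding c_def[symmetric] by (simp add: algebra_simps)
next
  assume p: "p = 0"
  define y where "y = (\<lambda>s. u s - s *\<^sub>R (\<i> * of_real q))"
  have "(y has_vector_derivative 0) (at s within UNIV)" for s
    unfolding y_def using u[of s] p by (auto intro!: derivative_eq_intros)
  then obtain k where k: "\<And>s. y s = k"
    using has_vector_derivative_zero_constant[of UNIV y] by auto
  then have "y t = y 0" by simp
  then show "u t = u 0 + \<i> * of_real q * of_real t"
    by (simp add: y_def scaleR_conv_of_real algebra_simps)
qed

section \<open>Groups of composition operators\<close>

theorem proposition4p4:
  fixes G :: "complex \<Rightarrow> complex" and \<phi> :: "real \<Rightarrow> complex \<Rightarrow> complex"
    and C :: "real \<Rightarrow> hardy \<Rightarrow> hardy" and D :: "hardy set"
  assumes "G holomorphic_on right_half_plane"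
    and "is_flow_of G \<phi>"
    and "\<And>t. is_composition_operator (\<phi> t) (C t)"
    and "generates_qc_group (derivation_operator G D) C"
  shows "\<exists>p q :: real.
     (\<forall>z\<in>right_half_plane. G z = of_real p * z + \<i> * of_real q) \<and>
     (p \<noteq> 0 \<longrightarrow> (\<forall>t. \<forall>z\<in>right_half_plane.
        \<phi> t z = z * exp (of_real (p * t)) + \<i> * of_real q / of_real p * (exp (of_real (p * t)) - 1))) \<and>
     (p = 0 \<longrightarrow> (\<forall>t. \<forall>z\<in>right_half_plane. \<phi> t z = z + \<i> * of_real q * of_real t))"
proof -
  have fl: "\<And>w s. w \<in> right_half_plane \<Longrightarrow> \<phi> s w \<in> right_half_plane"
    and dv: "\<And>w s. w \<in> right_half_plane \<Longrightarrow> ((\<lambda>s. \<phi> s w) has_vector_derivative G (\<phi> s w)) (at s)"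
    and z0: "\<And>w. w \<in> right_half_plane \<Longrightarrow> \<phi> 0 w = w"
    using assms(2) by (auto simp: is_flow_of_def)
  have bl: "bounded_linear (C (- t))" if "t \<ge> 0" for t
    using assms(4) that
    by (auto simp: generates_qc_group_def generates_qc_semigroup_def C0_semigroup_def)
  have affine: "\<exists>a b :: real. \<forall>z\<in>right_half_plane. \<phi> t z = of_real a * z + \<i> * of_real b"
    if t: "t \<ge> 0" for t
  proof -
    obtain K where K: "K > 0" "\<And>z. z \<in> right_half_plane \<Longrightarrow> Re z \<le> K * Re (\<phi> (- t) z)"
      using bounded_composition_operator_Re[OF assms(3) bl[OF t]] by blast
    show ?thesis
    proof (rule affine_from_Re_bound[OF _ K(1)])
      show "\<phi> t holomorphic_on right_half_plane"
        using assms(3)[of t] by (simp add: is_composition_operator_def)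
      fix z assume z: "z \<in> right_half_plane"
      have "Re (\<phi> t z) \<le> K * Re z"
        using K(2)[OF fl[OF z, of t]] flow_backwards[OF assms(1,2) t z] by simp
      moreover have "Re (\<phi> t z) > 0" using fl[OF z, of t] by (simp add: right_half_plane_def)
      ultimately show "\<bar>Re (\<phi> t z)\<bar> \<le> K * Re z" by simp
    qed
  qed
  then obtain a b :: "real \<Rightarrow> real"
    where ab: "\<And>t z. t \<ge> 0 \<Longrightarrow> z \<in> right_half_plane \<Longrightarrow> \<phi> t z = of_real (a t) * z + \<i> * of_real (b t)"
    by metis
  have quot: "((\<lambda>t. of_real ((a t - 1) / t) * z + \<i> * of_real (b t / t)) \<longlongrightarrow> G z) (at_right 0)"
    if z: "z \<in> right_half_plane" for z
  proof -
    have "((\<lambda>t. \<phi> t z) has_vector_derivative G z) (at_right 0)"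
      using dv[OF z, of 0] z0[OF z] has_vector_derivative_at_within by fastforce
    then have "((\<lambda>t. (\<phi> t z - z - t *\<^sub>R G z) /\<^sub>R \<bar>t\<bar>) \<longlongrightarrow> 0) (at_right 0)"
      by (simp add: has_vector_derivative_def has_derivative_at_within z0[OF z])
    moreover have "\<forall>\<^sub>F t in at_right 0.
        (\<phi> t z - z - t *\<^sub>R G z) /\<^sub>R \<bar>t\<bar> = (\<phi> t z - z) /\<^sub>R t - G z"
      unfolding eventually_at_right_field
      by (intro exI[of _ 1]) (auto simp: scaleR_diff_right)
    ultimately have "((\<lambda>t. (\<phi> t z - z) /\<^sub>R t - G z) \<longlongrightarrow> 0) (at_right 0)"
      by (rule Lim_transform_eventually)
    then have "((\<lambda>t. (\<phi> t z - z) /\<^sub>R t) \<longlongrightarrow> G z) (at_right 0)"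
      by (rule LIM_zero_cancel)
    then show ?thesis
    proof (rule tendsto_cong[THEN iffD1, rotated])
      show "\<forall>\<^sub>F t in at_right 0. (\<phi> t z - z) /\<^sub>R t
          = of_real ((a t - 1) / t) * z + \<i> * of_real (b t / t)"
        unfolding eventually_at_right_field
        by (intro exI[of _ 1])
          (auto simp: ab[OF _ z] scaleR_conv_of_real divide_simps algebra_simps)
    qed
  qed
  \<comment> \<open>At \<open>z = 1\<close> the two real coefficients of the difference quotient are its real and imaginary
    parts, so each of them converges.\<close>
  define p q where "p = Re (G 1)" and "q = Im (G 1)"
  have one: "1 \<in> right_half_plane" by (simp add: right_half_plane_def)
  have "((\<lambda>t. (a t - 1) / t) \<longlongrightarrow> p) (at_right 0)" "((\<lambda>t. b t / t) \<longlongrightarrow> q) (at_right 0)"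
    using tendsto_Re[OF quot[OF one]] tendsto_Im[OF quot[OF one]] by (simp_all add: p_def q_def)
  then have lim: "((\<lambda>t. of_real ((a t - 1) / t) * z + \<i> * of_real (b t / t))
      \<longlongrightarrow> of_real p * z + \<i> * of_real q) (at_right 0)" for z
    by (intro tendsto_intros)
  have G: "G z = of_real p * z + \<i> * of_real q" if "z \<in> right_half_plane" for z
    using tendsto_unique[OF _ quot[OF that] lim] by simp
  have "((\<lambda>s. \<phi> s z) has_vector_derivative of_real p * \<phi> t z + \<i> * of_real q) (at t)"
    if "z \<in> right_half_plane" for t z
    using dv[OF that, of t] G[OF fl[OF that]] by simp
  note sol = flow_of_affine_field[OF this, unfolded z0]
  show ?thesis
    using G sol z0 by (intro exI[of _ p] exI[of _ q]) auto
qed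

end
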